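(* Let $(B_k)_{k\ge 0}$ be the balancing sequence. The only solution of the Diophantine equation \[B_n+B_m=x^q\] in positive integers $n,m,x,q$ with $n\ge m$, $q\ge 2$ and $n\equiv m \pmod 2$ is $(n,m,x,q)=(3,1,6,2)$, that is, $B_3+B_1=35+1=6^2$.
   Context: The balancing sequence $(B_k)_{k\ge0}$ is defined by $B_0=0$, $B_1=1$ and $B_k=6B_{k-1}-B_{k-2}$ for $k\ge 2$; equivalently $B_k=\frac{\alpha^k-\beta^k}{4\sqrt2}$ with $\alpha=3+2\sqrt2$, $\beta=3-2\sqrt2$. *)

theory Defs
  imports Main
begin

fun balancing :: "nat \<Rightarrow> int" where
  "balancing 0 = 0"
| "balancing (Suc 0) = 1"
| "balancing (Suc (Suc k)) = 6 * balancing (Suc k) - balancing k"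

end

theory Submission
  imports Defs "HOL-Number_Theory.Number_Theory"
begin

text \<open>Put \<open>a = (n + m) / 2\<close>, \<open>b = (n - m) / 2\<close> and \<open>C\<^sub>k = (\<alpha>\<^sup>k + \<beta>\<^sup>k) / 2\<close>; then
  \<open>B\<^sub>n + B\<^sub>m = 2 B\<^sub>a C\<^sub>b\<close>. Write \<open>a = 2\<^sup>k A\<close> with \<open>A\<close> odd and split off the factors \<open>C\<^bsub>2^i A\<^esub>\<close> of
  \<open>B\<^sub>a\<close>, which are pairwise coprime. Parity excludes \<open>k = 0\<close>. If \<open>b\<close> is even, the odd-index term \<open>C\<^sub>A\<close>
  must be a \<open>q\<close>-th power, but it is a product of coprime numbers with difference \<open>2\<close>. If \<open>b\<close> is
  odd and \<open>k \<ge> 2\<close>, then \<open>C\<^bsub>2A\<^esub> = (4 B\<^sub>A)\<^sup>2 + 1\<close> is a \<open>q\<close>-th power, against Lebesgue's theorem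
  on \<open>x\<^sup>2 + 1 = y\<^sup>q\<close>. In the remaining case \<open>x\<^sup>q = 4 B\<^sub>A C\<^sub>A C\<^sub>b\<close> with odd factors, so \<open>q = 2\<close>;
  that \<open>B\<^sub>A\<close> is a square gives \<open>s\<^sup>4 + 1 = 2 t\<^sup>4\<close>, hence \<open>A = 1\<close>, and then
  \<open>3 C\<^sub>b\<close> is a square, which is a pair of simultaneous Pell equations forcing \<open>b = 1\<close>.\<close>

section \<open>Coprime factors of perfect powers, Pythagorean triples and Fermat descent\<close>

section \<open>Sums of fourth powers\<close>

text \<open>The root is \<open>gcd a c\<close>: its \<open>q\<close>-th power is the gcd of
  \<open>a ^ q\<close> and \<open>a * b\<close>, which is \<open>a\<close> times the gcd of
  \<open>a ^ (q - 1)\<close> and \<open>b\<close>, hence \<open>a\<close>.\<close>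

lemma coprime_mult_eq_power_int:
  fixes a b c :: int
  assumes "coprime a b" "a * b = c ^ q" "a > 0" "q > 0"
  obtains v where "v > 0" "a = v ^ q"
proof -
  obtain j where j: "q = Suc j" using \<open>q > 0\<close> gr0_implies_Suc by blast
  have "gcd a c ^ q = gcd (a ^ q) (c ^ q)" by (simp add: gcd_exp)
  also have "\<dots> = gcd (a * a ^ j) (a * b)" using assms(2) j by simp
  also have "\<dots> = a * gcd (a ^ j) b"
    using \<open>a > 0\<close> by (simp add: gcd_mult_left)
  also have "gcd (a ^ j) b = 1" using assms(1) by simp
  finally show thesis using that[of "gcd a c"] \<open>a > 0\<close> by simp
qed

lemma coprime_mult_eq_power2:
  fixes a b c :: int
  assumes "coprime a b" "a * b = c ^ q" "a > 0" "b > 0" "q > 0"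
  obtains v w where "v > 0" "w > 0" "a = v ^ q" "b = w ^ q"
proof -
  obtain v where "v > 0" "a = v ^ q" using coprime_mult_eq_power_int assms by metis
  moreover obtain w where "w > 0" "b = w ^ q"
    using coprime_mult_eq_power_int[of b a c q] assms
    by (metis coprime_commute mult.commute)
  ultimately show thesis using that by blast
qed

text \<open>Half sum and half difference of \<open>z\<close> and \<open>x\<close> are coprime with
  product \<open>(y / 2)^2\<close>, so both are squares.\<close>

lemma pythagorean_triple:
  fixes x y z :: int
  assumes eq: "x\<^sup>2 + y\<^sup>2 = z\<^sup>2" and "coprime x y" "odd x" "even y" "x > 0" "y > 0" "z > 0"
  obtains a b where "a > 0" "b > 0" "coprime a b" "odd (a + b)"
    "x = a\<^sup>2 - b\<^sup>2" "y = 2 * a * b" "z = a\<^sup>2 + b\<^sup>2"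
proof -
  have "odd z" using eq \<open>odd x\<close> \<open>even y\<close> by (metis even_add even_power zero_less_numeral)
  then obtain s t where st: "z + x = 2 * s" "z - x = 2 * t"
    using \<open>odd x\<close> by (metis dvdE even_diff odd_even_add)
  then have zx: "z = s + t" "x = s - t" by simp_all
  obtain w where w: "y = 2 * w" using \<open>even y\<close> by blast
  have st_w: "s * t = w\<^sup>2" using eq unfolding zx w by (simp add: power2_eq_square algebra_simps)
  have "x < z" using eq \<open>y > 0\<close> \<open>z > 0\<close>
    by (smt (verit) power2_less_imp_less zero_less_power)
  then have pos: "s > 0" "t > 0" using st \<open>x > 0\<close> \<open>z > 0\<close> by linarith+
  have "coprime s t"
  proof (rule coprimeI)
    fix d assume d: "d dvd s" "d dvd t"
    then have "d dvd x" "d ^ 2 dvd w ^ 2"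
      unfolding zx st_w[symmetric] by (simp_all add: power2_eq_square mult_dvd_mono)
    then have "d dvd x" "d dvd y" unfolding w by simp_all
    then show "is_unit d" using \<open>coprime x y\<close> by (meson coprime_common_divisor)
  qed
  then obtain a b where ab: "a > 0" "b > 0" "s = a\<^sup>2" "t = b\<^sup>2"
    using coprime_mult_eq_power2[of s t w 2] st_w pos by auto
  have "w\<^sup>2 = (a * b)\<^sup>2" using st_w ab by (simp add: power_mult_distrib)
  then have "w = a * b" using ab w \<open>y > 0\<close> by (simp add: power2_eq_iff_nonneg)
  moreover have "coprime a b" using \<open>coprime s t\<close> ab by simp
  moreover have "odd (a + b)" using \<open>odd x\<close> unfolding zx ab by simp
  ultimately show thesis using that[of a b] ab zx w by simp
qed

text \<open>As \<open>k^2 = 2 a b\<close> with coprime \<open>a\<close> and \<open>b\<close>, one of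
  them is \<open>2 e^2\<close> and the other \<open>f^2\<close> with \<open>f\<close> odd. Both
  quartic equations below bring their second Pythagorean triple here.\<close>

lemma square_legs_imp_x4_plus_4y4:
  fixes a b i k :: int
  assumes "a > 0" "b > 0" "coprime a b" "k\<^sup>2 = 2 * a * b" "i\<^sup>2 = a\<^sup>2 + b\<^sup>2"
  obtains e f where "e > 0" "f > 0" "coprime e f" "odd f" "f ^ 4 + 4 * e ^ 4 = i\<^sup>2"
proof -
  have "even (k\<^sup>2)" using assms by simp
  then obtain l where l: "k = 2 * l" by auto
  have main: "\<exists>e>0. \<exists>f>0. coprime e f \<and> odd f \<and> f ^ 4 + 4 * e ^ 4 = i\<^sup>2"
    if a: "a > 0" "b > 0" "coprime a b" "even a" "k\<^sup>2 = 2 * a * b" "i\<^sup>2 = a\<^sup>2 + b\<^sup>2" for a b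
  proof -
    have "odd b" using a(3,4) by (metis coprime_common_divisor odd_one)
    obtain c where c: "a = 2 * c" using \<open>even a\<close> by blast
    have "c * b = l\<^sup>2" using a(5) c l by (simp add: power2_eq_square)
    moreover have "coprime c b" using a(3) c by simp
    ultimately obtain e f where e: "e > 0" "f > 0" "c = e\<^sup>2" "b = f\<^sup>2"
      using coprime_mult_eq_power2[of c b l 2] a c by auto
    have "f ^ 4 + 4 * e ^ 4 = i\<^sup>2" unfolding a c e by (simp add: power_mult_distrib flip: power_mult)
    moreover have "coprime e f" "odd f" using \<open>coprime c b\<close> e \<open>odd b\<close> by simp_all
    ultimately show ?thesis using e by blast
  qed
  have "even a \<or> even b"
  proof -
    have "a * b = 2 * l\<^sup>2" using assms(4) l by (simp add: power2_eq_square)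
    then show ?thesis by (metis dvd_triv_left even_mult_iff)
  qed
  then show thesis
    using main[of a b] main[of b a] assms that by (auto simp: coprime_commute mult_ac add_ac)
qed

text \<open>Infinite descent on \<open>m\<close>. The triple \<open>f^2, 2 e^2, m\<close> has square
  parameters \<open>g = i^2\<close> and \<open>h = k^2\<close>, which gives a second triple
  \<open>f, k^2, i^2\<close>; its parameters yield a solution with \<open>i < m\<close> in place of
  \<open>m\<close>.\<close>

lemma fermat_x4_plus_4y4:
  fixes e f m :: int
  assumes "f ^ 4 + 4 * e ^ 4 = m\<^sup>2" "coprime e f" "odd f" "e > 0" "f > 0" "m > 0"
  shows False
  using assms
proof (induction "nat m" arbitrary: e f m rule: less_induct)
  case less
  have "(f\<^sup>2)\<^sup>2 + (2 * e\<^sup>2)\<^sup>2 = m\<^sup>2"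
    using less.prems(1) by (simp add: power_mult_distrib flip: power_mult)
  moreover have "coprime (f\<^sup>2) (2 * e\<^sup>2)"
    using less.prems by (simp add: coprime_commute)
  ultimately obtain g h where gh: "g > 0" "h > 0" "coprime g h" "odd (g + h)"
    "f\<^sup>2 = g\<^sup>2 - h\<^sup>2" "2 * e\<^sup>2 = 2 * g * h" "m = g\<^sup>2 + h\<^sup>2"
    using pythagorean_triple[of "f\<^sup>2" "2 * e\<^sup>2" m] less.prems by auto
  have "g * h = e\<^sup>2" using gh by simp
  then obtain i k where ik: "i > 0" "k > 0" "g = i\<^sup>2" "h = k\<^sup>2"
    using coprime_mult_eq_power2[of g h e 2] gh by auto
  have fk: "f\<^sup>2 + (k\<^sup>2)\<^sup>2 = (i\<^sup>2)\<^sup>2" using gh ik by simp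
  \<comment> \<open>If \<open>k\<close> were odd, \<open>i\<close> would be even, and
    \<open>f^2 + k^4 = i^4\<close> would read \<open>2 = 0\<close> modulo \<open>4\<close>.\<close>
  have "even (k\<^sup>2)"
  proof (rule ccontr)
    assume "odd (k\<^sup>2)"
    then have "even (i\<^sup>2)" using gh(4) ik by simp
    then have "4 dvd (i\<^sup>2)\<^sup>2" by (auto simp: power2_eq_square)
    moreover have "(f\<^sup>2 + (k\<^sup>2)\<^sup>2) mod 4 = 2"
    proof -
      have "w\<^sup>2 mod 4 = 1" if w: "odd w" for w :: int
      proof -
        obtain r where "w = 2 * r + 1" using w by (rule oddE)
        then have "w\<^sup>2 = 1 + 4 * (r\<^sup>2 + r)" by (simp add: power2_eq_square algebra_simps)
        then show ?thesis by (simp only: mod_mult_self2) simp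
      qed
      from this[of f] this[of "k\<^sup>2"] show ?thesis
        using \<open>odd f\<close> \<open>odd (k\<^sup>2)\<close> by presburger
    qed
    ultimately show False unfolding fk by presburger
  qed
  have "coprime f (k\<^sup>2)"
  proof (rule coprimeI)
    fix d assume d: "d dvd f" "d dvd k\<^sup>2"
    then have "d dvd f * f" "d dvd h * h" unfolding ik(4) by (metis dvd_mult2)+
    then have "d dvd g\<^sup>2" using gh(5) by (simp add: power2_eq_square) (metis diff_add_cancel dvd_add)
    moreover have "d dvd h" using d ik by simp
    moreover have "coprime (g\<^sup>2) h" using gh by simp
    ultimately show "is_unit d" by (meson coprime_common_divisor)
  qed
  then obtain a b where ab: "a > 0" "b > 0" "coprime a b" "odd (a + b)"
    "f = a\<^sup>2 - b\<^sup>2" "k\<^sup>2 = 2 * a * b" "i\<^sup>2 = a\<^sup>2 + b\<^sup>2"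
    using pythagorean_triple[of f "k\<^sup>2" "i\<^sup>2"] fk \<open>even (k\<^sup>2)\<close> less.prems ik by auto
  have "i < m"
  proof -
    have "i \<le> g" unfolding ik(3) using \<open>i > 0\<close> by (intro self_le_power) auto
    also have "g \<le> g\<^sup>2" using \<open>g > 0\<close> by (intro self_le_power) auto
    also have "\<dots> < m" using gh by simp
    finally show ?thesis .
  qed
  obtain e' f' where "e' > 0" "f' > 0" "coprime e' f'" "odd f'" "f' ^ 4 + 4 * e' ^ 4 = i\<^sup>2"
    using square_legs_imp_x4_plus_4y4 ab by blast
  then show False
    using less.hyps[of i f' e'] \<open>i < m\<close> ik less.prems by auto
qed

lemma coprime_if_square_relation:
  fixes s t :: int
  assumes "s ^ 4 + 1 = 2 * t ^ 4"
  shows "coprime s t"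
proof (rule coprimeI)
  fix d assume "d dvd s" "d dvd t"
  then have "d dvd s ^ 4" "d dvd 2 * t ^ 4" by (simp_all add: dvd_power_le dvd_mult numeral_eq_Suc)
  then show "is_unit d" using assms by (metis dvd_add_right_iff)
qed

text \<open>For \<open>s > 1\<close> put \<open>z = (s^4 - 1) / 2\<close>; squaring the equation
  gives \<open>(s^2)^2 + z^2 = (t^4)^2\<close>. Multiplying \<open>s^2 = m^2 - n^2\<close> by
  \<open>t^4 = m^2 + n^2\<close> gives the triple \<open>s t^2, n^2, m^2\<close>, and this one leads
  to the quartic excluded by \<open>fermat_x4_plus_4y4\<close>.\<close>

theorem fourth_powers_near_double:
  fixes s t :: int
  assumes eq: "s ^ 4 + 1 = 2 * t ^ 4" and "s > 0" "t > 0"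
  shows "s = 1"
proof (rule ccontr)
  assume "s \<noteq> 1"
  have "odd s" using eq by (metis dvd_triv_left even_power odd_add odd_one zero_less_numeral)
  then obtain r where r: "s = 2 * r + 1" by (rule oddE)
  then have "r > 0" using \<open>s > 0\<close> \<open>s \<noteq> 1\<close> by simp
  \<comment> \<open>This is \<open>(s^4 - 1) / 2\<close>, with \<open>(s^2 + 1) / 2\<close> written
    as \<open>r^2 + (r + 1)^2\<close>.\<close>
  define z where "z = (s\<^sup>2 - 1) * (r\<^sup>2 + (r + 1)\<^sup>2)"
  have "s\<^sup>2 + 1 = 2 * (r\<^sup>2 + (r + 1)\<^sup>2)" unfolding r by (simp add: power2_eq_square algebra_simps)
  then have z2: "2 * z = s ^ 4 - 1"
  proof -
    have "2 * z = (s\<^sup>2 - 1) * (s\<^sup>2 + 1)"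
      unfolding z_def \<open>s\<^sup>2 + 1 = _\<close> by simp
    then show ?thesis by (simp add: algebra_simps power2_eq_square power4_eq_xxxx)
  qed
  have "4 * z\<^sup>2 = (s ^ 4 - 1)\<^sup>2" unfolding z2[symmetric] by (simp add: power2_eq_square)
  also have "\<dots> = (s ^ 4 + 1)\<^sup>2 - 4 * s ^ 4" by (simp add: power2_eq_square algebra_simps)
  also have "\<dots> = 4 * ((t\<^sup>2)\<^sup>2)\<^sup>2 - 4 * (s\<^sup>2)\<^sup>2" unfolding eq by (simp add: power2_eq_square power4_eq_xxxx)
  finally have tri: "(s\<^sup>2)\<^sup>2 + z\<^sup>2 = ((t\<^sup>2)\<^sup>2)\<^sup>2" by simp
  have "even z" unfolding z_def using \<open>odd s\<close> by simp
  have "s > 1" using \<open>s > 0\<close> \<open>s \<noteq> 1\<close> by simp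
  then have "s ^ 4 > 1" by (simp add: one_less_power)
  then have "z > 0" using z2 by simp
  have st: "coprime s t" using coprime_if_square_relation eq by blast
  have "coprime (s\<^sup>2) z"
  proof (rule coprimeI)
    fix d assume d: "d dvd s\<^sup>2" "d dvd z"
    then have "d dvd (s\<^sup>2)\<^sup>2 + z\<^sup>2" by (simp add: power2_eq_square)
    moreover have "coprime (s\<^sup>2) (((t\<^sup>2)\<^sup>2)\<^sup>2)" using st by simp
    ultimately show "is_unit d" using d unfolding tri by (meson coprime_common_divisor)
  qed
  then obtain m n where mn: "m > 0" "n > 0" "coprime m n" "odd (m + n)"
    "s\<^sup>2 = m\<^sup>2 - n\<^sup>2" "z = 2 * m * n" "(t\<^sup>2)\<^sup>2 = m\<^sup>2 + n\<^sup>2"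
    using pythagorean_triple[of "s\<^sup>2" z "(t\<^sup>2)\<^sup>2"] tri \<open>odd s\<close> \<open>even z\<close> \<open>z > 0\<close> \<open>s > 0\<close> \<open>t > 0\<close> by auto
  \<comment> \<open>Otherwise \<open>m\<close> is even and \<open>s^2 = m^2 - n^2\<close> is
    \<open>-1\<close> modulo \<open>4\<close>, although \<open>s\<close> is odd.\<close>
  have "even n"
  proof (rule ccontr)
    assume "odd n"
    then have "even m" using mn by simp
    obtain m' where m': "m = 2 * m'" using \<open>even m\<close> by blast
    obtain n' where n': "n = 2 * n' + 1" using \<open>odd n\<close> by (rule oddE)
    have "4 * (r\<^sup>2 + r + n'\<^sup>2 + n' - m'\<^sup>2) = - 2"
      using mn(5) unfolding r m' n' by (simp add: power2_eq_square algebra_simps)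
    then show False by presburger
  qed
  have tri2: "(s * t\<^sup>2)\<^sup>2 + (n\<^sup>2)\<^sup>2 = (m\<^sup>2)\<^sup>2"
  proof -
    have "(s * t\<^sup>2)\<^sup>2 = (m\<^sup>2 - n\<^sup>2) * (m\<^sup>2 + n\<^sup>2)"
      unfolding mn(5)[symmetric] mn(7)[symmetric] by (simp add: power_mult_distrib)
    then show ?thesis by (simp add: power2_eq_square algebra_simps)
  qed
  have "odd m" using mn(4) \<open>even n\<close> by simp
  have "coprime (s * t\<^sup>2) (n\<^sup>2)"
  proof (rule coprimeI)
    fix d assume d: "d dvd s * t\<^sup>2" "d dvd n\<^sup>2"
    then have "d dvd (s * t\<^sup>2)\<^sup>2 + (n\<^sup>2)\<^sup>2" by (simp add: power2_eq_square)
    moreover have "coprime (n\<^sup>2) ((m\<^sup>2)\<^sup>2)" using mn(3) by (simp add: coprime_commute)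
    ultimately show "is_unit d" using d unfolding tri2 by (meson coprime_common_divisor)
  qed
  moreover have "odd (s * t\<^sup>2)"
    using tri2 \<open>odd m\<close> \<open>even n\<close> by (metis even_add even_power zero_less_numeral)
  ultimately obtain a b where ab: "a > 0" "b > 0" "coprime a b" "n\<^sup>2 = 2 * a * b" "m\<^sup>2 = a\<^sup>2 + b\<^sup>2"
    using pythagorean_triple[OF tri2] \<open>even n\<close> \<open>s > 0\<close> \<open>t > 0\<close> mn
    by (metis even_power zero_less_mult_iff zero_less_power zero_less_numeral)
  obtain e f where "e > 0" "f > 0" "coprime e f" "odd f" "f ^ 4 + 4 * e ^ 4 = m\<^sup>2"
    using square_legs_imp_x4_plus_4y4 ab by blast
  then show False using fermat_x4_plus_4y4 mn(1) by blast
qed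

section \<open>The Gaussian integers as a Euclidean ring, and the equation x^2 + 1 = y^q\<close>

section \<open>Lebesgue's equation\<close>

text \<open>A subset of the complex numbers rather than a new type: division, powers and
  \<open>cmod\<close> come from the field, and only closure has to be proved.\<close>

definition gaussian_ints :: "complex set" where
  "gaussian_ints = {Complex (of_int a) (of_int b) |a b. True}"

lemma gaussian_ints_iff:
  "z \<in> gaussian_ints \<longleftrightarrow> (\<exists>a b. z = of_int a + of_int b * \<i>)"
  by (auto simp: gaussian_ints_def complex_eq_iff)

lemma of_int_gaussian [simp]: "of_int a \<in> gaussian_ints"
  and i_gaussian [simp]: "\<i> \<in> gaussian_ints"
  unfolding gaussian_ints_iff
  by (metis add.right_neutral mult_zero_left of_int_0, metis add.left_neutral mult_1 of_int_0 of_int_1)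

lemma one_gaussian [simp]: "1 \<in> gaussian_ints"
  and zero_gaussian [simp]: "0 \<in> gaussian_ints"
  using of_int_gaussian[of 1] of_int_gaussian[of 0] by simp_all

lemma gaussian_add [intro]: "z \<in> gaussian_ints \<Longrightarrow> w \<in> gaussian_ints \<Longrightarrow> z + w \<in> gaussian_ints"
proof -
  assume "z \<in> gaussian_ints" "w \<in> gaussian_ints"
  then obtain a b c d where "z = of_int a + of_int b * \<i>" "w = of_int c + of_int d * \<i>"
    unfolding gaussian_ints_iff by blast
  then have "z + w = of_int (a + c) + of_int (b + d) * \<i>"
    by (simp add: complex_eq_iff)
  then show ?thesis unfolding gaussian_ints_iff by blast
qed

lemma gaussian_mult [intro]: "z \<in> gaussian_ints \<Longrightarrow> w \<in> gaussian_ints \<Longrightarrow> z * w \<in> gaussian_ints"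
proof -
  assume "z \<in> gaussian_ints" "w \<in> gaussian_ints"
  then obtain a b c d where "z = of_int a + of_int b * \<i>" "w = of_int c + of_int d * \<i>"
    unfolding gaussian_ints_iff by blast
  then have "z * w = of_int (a * c - b * d) + of_int (a * d + b * c) * \<i>"
    by (simp add: complex_eq_iff algebra_simps)
  then show ?thesis unfolding gaussian_ints_iff by blast
qed

lemma gaussian_diff [intro]: "z \<in> gaussian_ints \<Longrightarrow> w \<in> gaussian_ints \<Longrightarrow> z - w \<in> gaussian_ints"
proof -
  assume z: "z \<in> gaussian_ints" and w: "w \<in> gaussian_ints"
  have "z + of_int (-1) * w \<in> gaussian_ints"
    using z w by (intro gaussian_add gaussian_mult of_int_gaussian)
  then show ?thesis by simp
qed

lemma gaussian_power [intro]: "z \<in> gaussian_ints \<Longrightarrow> z ^ n \<in> gaussian_ints"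
  by (induction n) (simp_all add: gaussian_mult)

lemma gaussian_norm_nat:
  assumes "z \<in> gaussian_ints"
  shows "\<exists>n::nat. (cmod z)\<^sup>2 = of_nat n"
proof -
  obtain a b where "z = of_int a + of_int b * \<i>" using assms gaussian_ints_iff by blast
  then have "(cmod z)\<^sup>2 = of_int (a\<^sup>2 + b\<^sup>2)" by (simp add: cmod_power2)
  then show ?thesis by (metis of_int_of_nat_eq sum_power2_ge_zero zero_le_imp_eq_int)
qed

text \<open>Rounding both coordinates of \<open>a / b\<close> leaves an error of squared modulus at
  most \<open>1/2\<close>.\<close>

lemma gaussian_division:
  assumes "a \<in> gaussian_ints" "b \<in> gaussian_ints" "b \<noteq> 0"
  shows "\<exists>q\<in>gaussian_ints. cmod (a - q * b) < cmod b"
proof -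
  define u where "u = a / b"
  define q where "q = of_int (round (Re u)) + of_int (round (Im u)) * \<i>"
  have q: "q \<in> gaussian_ints" unfolding gaussian_ints_iff q_def by blast
  have "\<bar>Re (u - q)\<bar> \<le> 1/2" "\<bar>Im (u - q)\<bar> \<le> 1/2"
    using of_int_round_abs_le[of "Re u"] of_int_round_abs_le[of "Im u"]
    by (simp_all add: q_def abs_minus_commute)
  then have "(Re (u - q))\<^sup>2 \<le> (1/2)\<^sup>2" "(Im (u - q))\<^sup>2 \<le> (1/2)\<^sup>2"
    by (simp_all only: power2_le_iff_abs_le)
  then have "(cmod (u - q))\<^sup>2 < 1\<^sup>2"
    unfolding cmod_power2 by (simp add: power2_eq_square)
  then have "cmod (u - q) < 1" by (rule power_less_imp_less_base) simp
  moreover have "a - q * b = (u - q) * b" using assms by (simp add: u_def field_simps)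
  ultimately have "cmod (a - q * b) < cmod b"
    using assms by (simp add: norm_mult)
  with q show ?thesis by blast
qed

text \<open>\<open>z\<close> is a nonzero element of least norm in the ideal generated by
  \<open>a\<close> and \<open>c\<close>. The cofactors \<open>k\<close> and \<open>l\<close> are
  explicit because divisibility in the complex field carries no information.\<close>

lemma gaussian_bezout:
  assumes a: "a \<in> gaussian_ints" and c: "c \<in> gaussian_ints" and "a \<noteq> 0"
  obtains z r t k l where "z \<in> gaussian_ints" "r \<in> gaussian_ints" "t \<in> gaussian_ints"
    "k \<in> gaussian_ints" "l \<in> gaussian_ints" "z = r * a + t * c" "a = z * k" "c = z * l"
proof -
  define I where "I = {r * a + t * c |r t. r \<in> gaussian_ints \<and> t \<in> gaussian_ints}"
  define P where "P = (\<lambda>n. \<exists>z\<in>I. z \<noteq> 0 \<and> (cmod z)\<^sup>2 = of_nat n)"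
  have I: "I \<subseteq> gaussian_ints" using a c by (auto simp: I_def)
  have aI: "a \<in> I" and cI: "c \<in> I"
    unfolding I_def using zero_gaussian one_gaussian
    by (force intro: exI[of _ 1] exI[of _ 0])+
  have "\<exists>n. P n" unfolding P_def using gaussian_norm_nat[OF a] aI \<open>a \<noteq> 0\<close> by blast
  then have "P (LEAST n. P n)" by (rule LeastI_ex)
  then obtain z where z: "z \<in> I" "z \<noteq> 0" "(cmod z)\<^sup>2 = of_nat (LEAST n. P n)"
    unfolding P_def by blast
  have div: "\<exists>k\<in>gaussian_ints. w = z * k" if w: "w \<in> I" for w
  proof -
    obtain q where q: "q \<in> gaussian_ints" "cmod (w - q * z) < cmod z"
      using gaussian_division z w I by blast
    have wI: "w - q * z \<in> I"
    proof -
      obtain r t r' t' where "w = r * a + t * c" "z = r' * a + t' * c"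
        "r \<in> gaussian_ints" "t \<in> gaussian_ints" "r' \<in> gaussian_ints" "t' \<in> gaussian_ints"
        using w z unfolding I_def by blast
      moreover from this have "w - q * z = (r - q * r') * a + (t - q * t') * c"
        by (simp add: algebra_simps)
      ultimately show ?thesis unfolding I_def using q by blast
    qed
    \<comment> \<open>The remainder lies in the ideal and has smaller norm than
      \<open>z\<close>.\<close>
    have "w - q * z = 0"
    proof (rule ccontr)
      assume nz: "w - q * z \<noteq> 0"
      obtain n where n: "(cmod (w - q * z))\<^sup>2 = of_nat n" using gaussian_norm_nat wI I by blast
      then have "P n" unfolding P_def using wI nz by blast
      then have "(LEAST n. P n) \<le> n" by (rule Least_le)
      then have "(cmod z)\<^sup>2 \<le> (cmod (w - q * z))\<^sup>2" using z n by simp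
      with q(2) show False by (simp add: power2_le_iff_abs_le)
    qed
    with q show ?thesis by (intro bexI[of _ q]) (simp_all add: algebra_simps)
  qed
  obtain r t where "z = r * a + t * c" "r \<in> gaussian_ints" "t \<in> gaussian_ints"
    using z unfolding I_def by blast
  with div[OF aI] div[OF cI] z I that show ?thesis by blast
qed

text \<open>Counterpart of \<open>coprime_mult_eq_power_int\<close>: with \<open>z\<close> a gcd of
  \<open>a\<close> and \<open>c\<close>, the elements \<open>a\<close> and \<open>z ^ q\<close>
  divide each other, so their quotient is a unit \<open>u\<close> with inverse
  \<open>v\<close>.\<close>

lemma gaussian_coprime_power:
  assumes G: "a \<in> gaussian_ints" "b \<in> gaussian_ints" "c \<in> gaussian_ints"
    "r \<in> gaussian_ints" "t \<in> gaussian_ints"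
    and bezout: "r * a + t * b = 1" and prod: "a * b = c ^ q" and "a \<noteq> 0"
  obtains u v z where "u \<in> gaussian_ints" "v \<in> gaussian_ints" "z \<in> gaussian_ints"
    "u * v = 1" "a = u * z ^ q"
proof -
  obtain z r' t' k l where z: "z \<in> gaussian_ints" "r' \<in> gaussian_ints" "t' \<in> gaussian_ints"
    "k \<in> gaussian_ints" "l \<in> gaussian_ints" "z = r' * a + t' * c" "a = z * k" "c = z * l"
    using gaussian_bezout[OF G(1,3) \<open>a \<noteq> 0\<close>] .
  \<comment> \<open>\<open>z\<close> divides \<open>a\<close>, which is comaximal with
    \<open>b\<close>, so every power of \<open>z\<close> is comaximal with \<open>b\<close> as well.
    As \<open>z ^ q\<close> divides \<open>a * b = c ^ q\<close>, it then divides
    \<open>a\<close>.\<close>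
  have "\<exists>s\<in>gaussian_ints. \<exists>w\<in>gaussian_ints. 1 = z ^ n * s + b * w" for n
  proof (induction n)
    case 0
    then show ?case by (intro bexI[of _ 1] bexI[of _ 0]) auto
  next
    case (Suc n)
    then obtain s w where sw: "s \<in> gaussian_ints" "w \<in> gaussian_ints" "1 = z ^ n * s + b * w"
      by blast
    have "1 = (z ^ n * s + b * w) * (r * (z * k) + t * b)"
      using bezout sw(3) unfolding z(7) by (metis mult_1_right)
    also have "\<dots> = z ^ Suc n * (s * (r * k)) + b * (z ^ n * s * t + w * (r * (z * k) + t * b))"
      by (simp add: algebra_simps)
    finally show ?case using sw z(1-5) G
      by (intro bexI[of _ "s * (r * k)"] bexI[of _ "z ^ n * s * t + w * (r * (z * k) + t * b)"])
         (auto intro!: gaussian_add gaussian_mult gaussian_power)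
  qed
  then obtain s w where sw: "s \<in> gaussian_ints" "w \<in> gaussian_ints" "1 = z ^ q * s + b * w"
    by blast
  have "a = a * (z ^ q * s + b * w)" unfolding sw(3)[symmetric] by simp
  also have "\<dots> = z ^ q * (a * s) + a * b * w" by (simp add: algebra_simps)
  also have "\<dots> = (a * s + l ^ q * w) * z ^ q"
    unfolding prod z(8) by (simp add: algebra_simps power_mult_distrib)
  finally have 1: "a = (a * s + l ^ q * w) * z ^ q" .
  \<comment> \<open>Modulo \<open>a\<close>, \<open>z\<close> is congruent to \<open>t' * c\<close>;
    since \<open>a\<close> divides \<open>c ^ q\<close>, it also divides
    \<open>z ^ q\<close>.\<close>
  have "\<exists>s\<in>gaussian_ints. z ^ n = a * s + (t' * c) ^ n" for n
  proof (induction n)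
    case 0
    then show ?case by (intro bexI[of _ 0]) auto
  next
    case (Suc n)
    then obtain s where s: "s \<in> gaussian_ints" "z ^ n = a * s + (t' * c) ^ n" by blast
    have "z ^ Suc n = (r' * a + t' * c) * (a * s + (t' * c) ^ n)"
      unfolding power_Suc s(2) by (subst z(6)) (rule refl)
    also have "\<dots> = a * (s * (r' * a + t' * c) + r' * (t' * c) ^ n) + (t' * c) ^ Suc n"
      by (simp add: algebra_simps)
    finally show ?case using s z(1-5) G
      by (intro bexI[of _ "s * (r' * a + t' * c) + r' * (t' * c) ^ n"])
         (auto intro!: gaussian_add gaussian_mult gaussian_power)
  qed
  then obtain s' where s': "s' \<in> gaussian_ints" "z ^ q = a * s' + (t' * c) ^ q" by blast
  have 2: "z ^ q = a * (s' + t' ^ q * b)"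
    unfolding s'(2) power_mult_distrib prod[symmetric] by (simp add: algebra_simps)
  show thesis
  proof
    show "a = (a * s + l ^ q * w) * z ^ q" by (fact 1)
    show "a * s + l ^ q * w \<in> gaussian_ints" "s' + t' ^ q * b \<in> gaussian_ints" "z \<in> gaussian_ints"
      using G z(1-5) sw s' by auto
    have "a * 1 = a * ((a * s + l ^ q * w) * (s' + t' ^ q * b))"
      using 1 2 by (metis mult.assoc mult.commute mult_1_right)
    then show "(a * s + l ^ q * w) * (s' + t' ^ q * b) = 1"
      using \<open>a \<noteq> 0\<close> by (metis mult_left_cancel)
  qed
qed

lemma gaussian_unit_power4:
  assumes "u \<in> gaussian_ints" "v \<in> gaussian_ints" "u * v = 1"
  shows "u ^ 4 = 1"
proof -
  obtain a b where u: "u = of_int a + of_int b * \<i>"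
    using assms(1) unfolding gaussian_ints_iff by blast
  obtain m n :: nat where mn: "(cmod u)\<^sup>2 = of_nat m" "(cmod v)\<^sup>2 = of_nat n"
    using gaussian_norm_nat[OF assms(1)] gaussian_norm_nat[OF assms(2)] by blast
  have "(cmod u)\<^sup>2 * (cmod v)\<^sup>2 = 1"
    using assms(3) by (metis norm_mult norm_one power_mult_distrib power_one)
  then have "of_nat (m * n) = (1::real)" using mn by simp
  then have "m = 1" by (metis nat_mult_eq_1_iff of_nat_eq_1_iff)
  then have "real_of_int (a\<^sup>2 + b\<^sup>2) = 1" using mn u by (simp add: cmod_power2)
  then have *: "a\<^sup>2 + b\<^sup>2 = 1" by linarith
  have "a\<^sup>2 = 0 \<or> a\<^sup>2 = 1" "b\<^sup>2 = 0 \<or> b\<^sup>2 = 1"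
    using * zero_le_power2[of a] zero_le_power2[of b] by linarith+
  then have "a = 0 \<or> a = 1 \<or> a = -1" "b = 0 \<or> b = 1 \<or> b = -1"
    by (simp_all add: power2_eq_1_iff)
  then have "(a = 0 \<and> b = 1) \<or> (a = 0 \<and> b = -1) \<or> (a = 1 \<and> b = 0) \<or> (a = -1 \<and> b = 0)"
    using * by (elim disjE) simp_all
  then show ?thesis unfolding u by (elim disjE) simp_all
qed

text \<open>Every imaginary term of the binomial expansion contains \<open>d\<close>. For a power
  with imaginary part \<open>1\<close> this forces \<open>d\<close> to be \<open>1\<close> or
  \<open>-1\<close>.\<close>

lemma imaginary_part_dvd:
  fixes c d :: int
  shows "\<exists>a b. (of_int c + of_int d * \<i>) ^ n = of_int a + of_int (d * b) * \<i>"
proof (induction n)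
  case 0
  show ?case by (intro exI[of _ 1] exI[of _ 0]) simp
next
  case (Suc n)
  then obtain a b where "(of_int c + of_int d * \<i>) ^ n = of_int a + of_int (d * b) * \<i>" by blast
  then have "(of_int c + of_int d * \<i>) ^ Suc n = of_int (c * a - d * d * b) + of_int (d * (a + c * b)) * \<i>"
    by (simp add: complex_eq_iff algebra_simps)
  then show ?case by blast
qed

text \<open>Squaring doubles \<open>2 ^ k * e^2 * o'\<close> to first order. The quadratic terms
  change the new cofactor by an even amount, because \<open>e\<close> is even, so the cofactor stays
  odd.\<close>

lemma two_adic_doubling:
  fixes e :: int
  assumes "even e"
  shows "\<exists>o' b. odd o' \<and> (1 - of_int e * \<i>) ^ (2 ^ Suc k)
    = of_int (1 + 2 ^ k * e\<^sup>2 * o') + of_int (2 ^ Suc k * e * b) * \<i>"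
proof (induction k)
  case 0
  show ?case by (intro exI[of _ "-1"]) (simp add: complex_eq_iff power2_eq_square)
next
  case (Suc k)
  then obtain o' b where ob: "odd o'" "(1 - of_int e * \<i>) ^ (2 ^ Suc k)
    = of_int (1 + 2 ^ k * e\<^sup>2 * o') + of_int (2 ^ Suc k * e * b) * \<i>" by blast
  obtain f where f: "e = 2 * f" using assms by blast
  define A where "A = 1 + 2 ^ k * e\<^sup>2 * o'"
  define B where "B = 2 ^ Suc k * e * b"
  have "(1 - of_int e * \<i>) ^ (2 ^ Suc (Suc k)) = ((1 - of_int e * \<i>) ^ (2 ^ Suc k))\<^sup>2"
    by (simp flip: power_mult)
  also have "\<dots> = of_int (A\<^sup>2 - B\<^sup>2) + of_int (2 * A * B) * \<i>"
    unfolding ob A_def[symmetric] B_def[symmetric]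
    by (simp add: complex_eq_iff power2_eq_square algebra_simps)
  also have "A\<^sup>2 - B\<^sup>2 = 1 + 2 ^ Suc k * e\<^sup>2 * (o' + 2 * (2 ^ k * f\<^sup>2 * o'\<^sup>2 - 2 ^ k * b\<^sup>2))"
    unfolding A_def B_def f by (simp add: power2_eq_square algebra_simps)
  also have "2 * A * B = 2 ^ Suc (Suc k) * e * (A * b)"
    unfolding B_def by simp
  finally show ?case using ob(1) by (metis dvd_triv_left odd_add)
qed

text \<open>The cofactor of \<open>2\<^sup>k e\<^sup>2\<close> in the real part is odd, so the real part cannot return to \<open>1\<close>.\<close>

lemma two_adic_power:
  fixes e :: int
  assumes "even e"
  shows "\<exists>o' b. (odd o' \<longleftrightarrow> odd g) \<and> (1 - of_int e * \<i>) ^ (2 ^ Suc k * g)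
    = of_int (1 + 2 ^ k * e\<^sup>2 * o') + of_int (2 ^ Suc k * e * b) * \<i>"
proof (induction g)
  case 0
  show ?case by (intro exI[of _ 0]) simp
next
  case (Suc g)
  then obtain o1 b1 where 1: "odd o1 \<longleftrightarrow> odd g" "(1 - of_int e * \<i>) ^ (2 ^ Suc k * g)
    = of_int (1 + 2 ^ k * e\<^sup>2 * o1) + of_int (2 ^ Suc k * e * b1) * \<i>" by blast
  obtain o2 b2 where 2: "odd o2" "(1 - of_int e * \<i>) ^ (2 ^ Suc k)
    = of_int (1 + 2 ^ k * e\<^sup>2 * o2) + of_int (2 ^ Suc k * e * b2) * \<i>"
    using two_adic_doubling[OF assms] by blast
  obtain f where f: "e = 2 * f" using assms by blast
  define A where "A = 1 + 2 ^ k * e\<^sup>2 * o1"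
  define A' where "A' = 1 + 2 ^ k * e\<^sup>2 * o2"
  define B where "B = 2 ^ Suc k * e * b1"
  define B' where "B' = 2 ^ Suc k * e * b2"
  have "(1 - of_int e * \<i>) ^ (2 ^ Suc k * Suc g)
      = (1 - of_int e * \<i>) ^ (2 ^ Suc k * g) * (1 - of_int e * \<i>) ^ (2 ^ Suc k)"
    by (simp flip: power_add add: algebra_simps)
  also have "\<dots> = of_int (A * A' - B * B') + of_int (A * B' + A' * B) * \<i>"
    unfolding 1 2 A_def[symmetric] B_def[symmetric] A'_def[symmetric] B'_def[symmetric]
    by (simp add: complex_eq_iff algebra_simps)
  also have "A * A' - B * B' = 1 + 2 ^ k * e\<^sup>2 * (o1 + o2 + 2 * (2 * 2 ^ k * f\<^sup>2 * o1 * o2 - 2 * 2 ^ k * b1 * b2))"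
    unfolding A_def A'_def B_def B'_def f by (simp add: power2_eq_square algebra_simps)
  also have "A * B' + A' * B = 2 ^ Suc k * e * (A * b2 + A' * b1)"
    unfolding B_def B'_def by (simp add: algebra_simps)
  finally have eq: "(1 - of_int e * \<i>) ^ (2 ^ Suc k * Suc g) =
      of_int (1 + 2 ^ k * e\<^sup>2 * (o1 + o2 + 2 * (2 * 2 ^ k * f\<^sup>2 * o1 * o2 - 2 * 2 ^ k * b1 * b2)))
      + of_int (2 ^ Suc k * e * (A * b2 + A' * b1)) * \<i>" .
  have "odd (o1 + o2 + 2 * (2 * 2 ^ k * f\<^sup>2 * o1 * o2 - 2 * 2 ^ k * b1 * b2)) \<longleftrightarrow> odd (Suc g)"
    using 1(1) 2(1) by simp
  with eq show ?case by blast
qed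

lemma odd_eq_one_plus_two_power:
  fixes q :: nat
  assumes "odd q" "q > 1"
  obtains k g where "odd g" "q = 2 ^ Suc k * g + 1"
proof -
  obtain j where j: "q - 1 = 2 ^ multiplicity 2 (q - 1) * j" "\<not> 2 dvd j"
    using multiplicity_decompose'[of "q - 1" 2] assms by auto
  have "even (q - 1)" using assms by simp
  then have "multiplicity 2 (q - 1) \<noteq> 0" using j by (metis mult_1 power_0)
  then obtain k where "multiplicity 2 (q - 1) = Suc k" using not0_implies_Suc by blast
  with j that[of j k] assms show thesis by simp
qed

text \<open>Write \<open>q = 2 ^ Suc k * g + 1\<close> with \<open>g\<close> odd. The last factor
  \<open>1 - e i\<close> turns the real part into \<open>1 + 2^k e^2 (o' + 2 b')\<close>, where the
  bracket is odd and so cannot vanish; the value \<open>-1\<close> is excluded modulo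
  \<open>4\<close>.\<close>

lemma real_part_power_unit:
  fixes e a b :: int
  assumes "even e" "odd q" "q > 1"
    and eq: "(1 - of_int e * \<i>) ^ q = of_int a + of_int b * \<i>" and "\<bar>a\<bar> = 1"
  shows "e = 0"
proof (rule ccontr)
  assume "e \<noteq> 0"
  obtain k g where g: "odd g" "q = 2 ^ Suc k * g + 1"
    using odd_eq_one_plus_two_power assms by blast
  obtain o' b' where o: "odd o'" "(1 - of_int e * \<i>) ^ (2 ^ Suc k * g)
    = of_int (1 + 2 ^ k * e\<^sup>2 * o') + of_int (2 ^ Suc k * e * b') * \<i>"
    using two_adic_power[OF assms(1)] g by blast
  have "(1 - of_int e * \<i>) ^ q = (1 - of_int e * \<i>) ^ (2 ^ Suc k * g) * (1 - of_int e * \<i>)"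
    unfolding g(2) by simp
  also have "Re \<dots> = of_int (1 + 2 ^ k * e\<^sup>2 * (o' + 2 * b'))"
    unfolding o by (simp add: algebra_simps power2_eq_square)
  finally have "real_of_int a = of_int (1 + 2 ^ k * e\<^sup>2 * (o' + 2 * b'))"
    unfolding eq by simp
  then have a: "a = 1 + 2 ^ k * e\<^sup>2 * (o' + 2 * b')" by linarith
  have "4 dvd e\<^sup>2" using assms(1) by (auto simp: power2_eq_square)
  then have "4 dvd a - 1" unfolding a by auto
  then have "a = 1" using \<open>\<bar>a\<bar> = 1\<close> by presburger
  with a \<open>e \<noteq> 0\<close> have "o' + 2 * b' = 0" by simp
  with o(1) show False by presburger
qed

text \<open>For even \<open>x\<close> the factors \<open>x + i\<close> and \<open>x - i\<close> are
  comaximal, so \<open>x + i\<close> is a unit times a \<open>q\<close>-th power, and the unit is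
  absorbed. Comparing imaginary parts leads to \<open>real_part_power_unit\<close>.\<close>

theorem lebesgue_square_plus_one:
  fixes x y :: int
  assumes eq: "x\<^sup>2 + 1 = y ^ q" and "even x" "odd q" "q > 1"
  shows "x = 0"
proof -
  define a where "a = of_int x + \<i>"
  define b where "b = of_int x - \<i>"
  have ab: "a * b = of_int y ^ q"
  proof -
    have "a * b = of_int (x\<^sup>2 + 1)"
      unfolding a_def b_def by (simp add: complex_eq_iff power2_eq_square)
    then show ?thesis unfolding eq by simp
  qed
  obtain j where j: "x = 2 * j" using \<open>even x\<close> by blast
  have G: "a \<in> gaussian_ints" "b \<in> gaussian_ints"
    unfolding a_def b_def by auto
  have "a \<noteq> 0" unfolding a_def by (simp add: complex_eq_iff)
  \<comment> \<open>Chosen so that \<open>k * (a - b) = - x^2\<close>, which cancels against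
    \<open>a * b = x^2 + 1\<close> and leaves \<open>1\<close>.\<close>
  define k where "k = of_int (2 * j\<^sup>2) * \<i>"
  have "(b + k) * a + (- k) * b = a * b + k * (a - b)" by (simp add: algebra_simps)
  also have "a * b = of_int (4 * j\<^sup>2 + 1)"
    unfolding ab of_int_power[symmetric] eq[symmetric] j by (simp add: power_mult_distrib)
  also have "a - b = 2 * \<i>" unfolding a_def b_def by simp
  also have "k * (2 * \<i>) = of_int (- 4 * j\<^sup>2)" unfolding k_def by simp
  also have "of_int (4 * j\<^sup>2 + 1) + of_int (- 4 * j\<^sup>2) = (1::complex)" by simp
  finally have bez: "(b + k) * a + (- k) * b = 1" .
  have kG: "b + k \<in> gaussian_ints" "- k \<in> gaussian_ints"
  proof -
    show "b + k \<in> gaussian_ints" unfolding k_def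
      by (intro gaussian_add gaussian_mult G of_int_gaussian i_gaussian)
    have "- k = of_int (- 2 * j\<^sup>2) * \<i>" unfolding k_def by simp
    then show "- k \<in> gaussian_ints" by (metis gaussian_mult i_gaussian of_int_gaussian)
  qed
  obtain u v z where u: "u \<in> gaussian_ints" "v \<in> gaussian_ints" "z \<in> gaussian_ints"
    "u * v = 1" "a = u * z ^ q"
    by (rule gaussian_coprime_power[OF G of_int_gaussian kG bez ab \<open>a \<noteq> 0\<close>])
  have u4: "u ^ 4 = 1" using gaussian_unit_power4 u by blast
  obtain h where h: "q = 2 * h + 1" using \<open>odd q\<close> by (auto elim: oddE)
  \<comment> \<open>For odd \<open>q\<close> the square \<open>q^2\<close> is \<open>1\<close>
    modulo \<open>4\<close>, so \<open>u\<close> is the \<open>q\<close>-th power of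
    \<open>u ^ q\<close>.\<close>
  have "(u ^ q) ^ q = u ^ (4 * (h\<^sup>2 + h) + 1)"
    unfolding h power_mult[symmetric] by (simp add: power2_eq_square algebra_simps)
  also have "\<dots> = u" unfolding power_add power_mult u4 by simp
  finally have "a = (u ^ q * z) ^ q" using u by (simp add: power_mult_distrib)
  moreover have "u ^ q * z \<in> gaussian_ints" using u(1,3) by auto
  then obtain c d where "u ^ q * z = of_int c + of_int d * \<i>"
    unfolding gaussian_ints_iff by blast
  ultimately have cd: "a = (of_int c + of_int d * \<i>) ^ q" by simp
  obtain a' b' where "(of_int c + of_int d * \<i>) ^ q = of_int a' + of_int (d * b') * \<i>"
    using imaginary_part_dvd by blast
  then have "Im a = real_of_int (d * b')" unfolding cd by simp
  moreover have "Im a = 1" unfolding a_def by simp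
  ultimately have "d * b' = 1" by (metis of_int_eq_1_iff)
  then have d: "d = 1 \<or> d = -1" by (auto simp: zmult_eq_1_iff)
  \<comment> \<open>Comparison of norms, to see that \<open>c\<close> is even:
    \<open>x^2 + 1\<close> is odd and \<open>d^2 = 1\<close>.\<close>
  have "real_of_int (y ^ q) = (cmod a)\<^sup>2"
    unfolding eq[symmetric] a_def by (simp add: cmod_power2)
  also have "\<dots> = ((cmod (of_int c + of_int d * \<i>))\<^sup>2) ^ q"
    unfolding cd by (simp add: norm_power mult.commute flip: power_mult)
  also have "\<dots> = real_of_int ((c\<^sup>2 + d\<^sup>2) ^ q)"
    by (simp add: cmod_power2)
  finally have "x\<^sup>2 + 1 = (c\<^sup>2 + d\<^sup>2) ^ q" unfolding eq by linarith
  moreover have "odd (x\<^sup>2 + 1)" using \<open>even x\<close> by simp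
  ultimately have "even c" using d \<open>q > 1\<close> by auto
  \<comment> \<open>As \<open>d^2 = 1\<close>, \<open>c + d i = d i (1 - e i)\<close>. Since
    \<open>i ^ q\<close> is \<open>i\<close> or \<open>-i\<close>, the imaginary part
    \<open>1\<close> of \<open>a\<close> is, up to sign, the real part of
    \<open>(1 - e i)^q\<close>.\<close>
  define e where "e = c * d"
  have "even e" using \<open>even c\<close> by (simp add: e_def)
  have "of_int c + of_int d * \<i> = of_int d * \<i> * (1 - of_int e * \<i>)"
    using d unfolding e_def by (auto simp: complex_eq_iff)
  then have aeq: "a = of_int (d ^ q) * \<i> ^ q * (1 - of_int e * \<i>) ^ q"
    unfolding cd by (simp add: power_mult_distrib)
  have "of_int 1 + of_int (- e) * \<i> = 1 - of_int e * \<i>" by simp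
  then obtain A B where AB: "(1 - of_int e * \<i>) ^ q = of_int A + of_int B * \<i>"
    using imaginary_part_dvd[of 1 "- e" q] by metis
  have iq: "\<i> ^ q = \<i> \<or> \<i> ^ q = - \<i>"
    unfolding h power_add power_mult by (auto simp: power_minus_odd uminus_power_if)
  have dq: "d ^ q = 1 \<or> d ^ q = -1" using d \<open>odd q\<close> by auto
  have "\<bar>Im a\<bar> = \<bar>real_of_int A\<bar>"
    unfolding aeq AB using iq dq by (elim disjE) simp_all
  then have "real_of_int \<bar>A\<bar> = 1" unfolding \<open>Im a = 1\<close> by simp
  then have "\<bar>A\<bar> = 1" by (metis of_int_eq_1_iff)
  then have "e = 0" using real_part_power_unit AB \<open>even e\<close> assms by blast
  then have "Re a = 0" unfolding aeq using iq dq by (elim disjE) simp_all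
  then show ?thesis unfolding a_def by simp
qed

section \<open>Powers of 2 + sqrt 3, divisors of w^2 + 5, and Cohn's method\<close>

section \<open>Simultaneous Pell equations\<close>

text \<open>The coordinates of \<open>(2 + sqrt 3) ^ n\<close> in the basis
  \<open>1, sqrt 3\<close>, paired because each recurrence uses both.\<close>

fun pell3 :: "nat \<Rightarrow> int \<times> int" where
  "pell3 0 = (1, 0)"
| "pell3 (Suc n) = (2 * fst (pell3 n) + 3 * snd (pell3 n), fst (pell3 n) + 2 * snd (pell3 n))"

abbreviation "pt n \<equiv> fst (pell3 n)"
abbreviation "ps n \<equiv> snd (pell3 n)"

lemma pell3_norm: "(pt n)\<^sup>2 - 3 * (ps n)\<^sup>2 = 1"
  by (induction n) (simp_all add: power2_eq_square algebra_simps)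

lemma pell3_add:
  "pt (m + n) = pt m * pt n + 3 * ps m * ps n \<and> ps (m + n) = pt m * ps n + ps m * pt n"
  by (induction m) (simp_all add: algebra_simps)

lemma pell3_pos: "pt n > 0 \<and> ps n \<ge> 0"
  by (induction n) auto

lemma pell3_double:
  "pt (2 * n) = 2 * (pt n)\<^sup>2 - 1" "ps (2 * n) = 2 * pt n * ps n"
  using pell3_add[of n n] pell3_norm[of n] unfolding mult_2[of n]
  by (simp_all add: power2_eq_square algebra_simps)

text \<open>Descent on \<open>z\<close>: multiplication by \<open>2 - sqrt 3\<close> sends
  \<open>(x, z)\<close> to \<open>(2 x - 3 z, 2 z - x)\<close>, and for \<open>z > 0\<close> this is
  again an admissible solution with smaller second coordinate.\<close>

lemma pell3_complete:
  assumes "x\<^sup>2 - 3 * z\<^sup>2 = 1" "x > 0" "z \<ge> 0"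
  shows "\<exists>n. x = pt n \<and> z = ps n"
  using assms
proof (induction "nat z" arbitrary: x z rule: less_induct)
  case less
  show ?case
  proof (cases "z = 0")
    case True
    then have "x = 1" using less.prems by (auto simp: power2_eq_1_iff)
    with True show ?thesis by (intro exI[of _ 0]) simp
  next
    case False
    have "z < x"
    proof (rule power2_less_imp_less)
      show "z\<^sup>2 < x\<^sup>2" using less.prems by (smt (verit) zero_le_power2)
    qed (use less.prems in auto)
    have "x \<le> 2 * z"
    proof (rule power2_le_imp_le)
      have "z\<^sup>2 \<ge> 1" using False less.prems by (simp add: self_le_power int_one_le_iff_zero_less)
      then show "x\<^sup>2 \<le> (2 * z)\<^sup>2" using less.prems by (simp add: power_mult_distrib)
    qed (use less.prems in auto)
    have "(3 * z)\<^sup>2 < (2 * x)\<^sup>2" using less.prems by (simp add: power_mult_distrib) (smt (verit) zero_le_power2)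
    then have "3 * z < 2 * x" using less.prems by (intro power2_less_imp_less[of "3 * z"]) auto
    moreover have "(2 * x - 3 * z)\<^sup>2 - 3 * (2 * z - x)\<^sup>2 = 1"
      using less.prems(1) by (simp add: power2_eq_square algebra_simps)
    ultimately obtain n where n: "2 * x - 3 * z = pt n" "2 * z - x = ps n"
      using less.hyps[of "2 * z - x" "2 * x - 3 * z"] \<open>z < x\<close> \<open>x \<le> 2 * z\<close> False less.prems by auto
    have "x = pt (Suc n)" "z = ps (Suc n)" using n by simp_all
    then show ?thesis by blast
  qed
qed

text \<open>Raising the index by \<open>2 * k\<close> multiplies by \<open>pt (2 * k)\<close> and
  adds a multiple of \<open>ps (2 * k)\<close>, itself a multiple of \<open>pt k\<close>.\<close>

lemma pell3_dvd_odd_multiple: "pt k dvd pt (k * (2 * j + 1))"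
proof (induction j)
  case 0
  show ?case by simp
next
  case (Suc j)
  have eq: "k * (2 * Suc j + 1) = k * (2 * j + 1) + 2 * k" by (simp add: algebra_simps)
  have "pt (k * (2 * Suc j + 1))
      = pt (k * (2 * j + 1)) * pt (2 * k) + 3 * ps (k * (2 * j + 1)) * ps (2 * k)"
    unfolding eq using pell3_add by blast
  moreover have "pt k dvd ps (2 * k)" by (simp add: pell3_double)
  ultimately show ?case using Suc.IH by (metis dvd_add dvd_mult dvd_mult2)
qed

lemma pell3_parity: "(even (pt n) \<longleftrightarrow> odd n) \<and> (even (ps n) \<longleftrightarrow> even n)"
  by (induction n) auto

text \<open>Doubling the index replaces \<open>t\<close> by \<open>2 t^2 - 1\<close>, which fixes
  \<open>17\<close> modulo \<open>20\<close>, and \<open>pt 4 = 97\<close>. The residue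
  \<open>17\<close> is the one that \<open>dvd_square_plus_5\<close> rules out.\<close>

lemma pell3_power2_mod_20:
  "r \<ge> 2 \<Longrightarrow> pt (2 ^ r) mod 20 = 17"
proof (induction r rule: nat_induct_at_least)
  case base
  show ?case by (simp add: numeral_eq_Suc)
next
  case (Suc r)
  define k where "k = pt (2 ^ r) div 20"
  have k: "pt (2 ^ r) = 17 + 20 * k" unfolding k_def using Suc.IH by presburger
  have "pt (2 ^ Suc r) = 17 + 20 * (40 * k\<^sup>2 + 68 * k + 28)"
    unfolding power_Suc pell3_double k by (simp add: power2_eq_square algebra_simps)
  then show ?case by (simp only: mod_mult_self2) simp
qed

text \<open>Since \<open>-5\<close> is a square modulo \<open>p\<close>, Euler's criterion makes the
  symbols of \<open>-1\<close> and \<open>5\<close> equal, and reciprocity turns the latter into the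
  symbol of \<open>p\<close> modulo \<open>5\<close>. So \<open>p\<close> is \<open>1\<close> modulo
  \<open>4\<close> and a square modulo \<open>5\<close>, or \<open>3\<close> modulo \<open>4\<close>
  and a nonsquare.\<close>

lemma prime_dvd_square_plus_5:
  fixes p :: nat and w :: int
  assumes "prime p" "int p dvd w\<^sup>2 + 5" "p \<noteq> 2" "p \<noteq> 5"
  shows "p mod 20 \<in> {1, 3, 7, 9}"
proof -
  have p2: "2 < p" using assms prime_ge_2_nat[of p] by linarith
  have "odd p" using assms p2 prime_odd_nat by blast
  have np: "\<not> [a = 0] (mod int p)" if "\<bar>a\<bar> \<in> {1, 5}" for a :: int
  proof
    assume "[a = 0] (mod int p)"
    then have "int p dvd \<bar>a\<bar>" by (simp add: cong_0_iff)
    then have "p dvd 1 \<or> p dvd 5" using that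
      by (metis (no_types, opaque_lifting) insertE int_dvd_int_iff of_nat_1 of_nat_numeral singletonD)
    then have "p dvd 5" using \<open>prime p\<close> by auto
    then show False using \<open>prime p\<close> \<open>p \<noteq> 5\<close> primes_dvd_imp_eq[of p 5] by simp
  qed
  have "[w\<^sup>2 = -5] (mod int p)" using assms(2) by (simp add: cong_iff_dvd_diff)
  then have "QuadRes (int p) (-5)" unfolding QuadRes_def by blast
  then have L5: "Legendre (-5) (int p) = 1" unfolding Legendre_def using np[of "-5"] by simp
  have eu: "[Legendre a (int p) = a ^ ((p - 1) div 2)] (mod int p)" for a
    using euler_criterion[OF \<open>prime p\<close> p2] by blast
  have "[(-1) ^ ((p - 1) div 2) * Legendre 5 (int p) = (-1) ^ ((p - 1) div 2) * 5 ^ ((p - 1) div 2)] (mod int p)"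
    using eu by (intro cong_mult cong_refl)
  also have "(-1) ^ ((p - 1) div 2) * 5 ^ ((p - 1) div 2) = (-5 :: int) ^ ((p - 1) div 2)"
    by (simp flip: power_mult_distrib)
  also have "[(-5 :: int) ^ ((p - 1) div 2) = 1] (mod int p)"
    using eu[of "-5"] unfolding L5 by (rule cong_sym)
  finally have c: "[(-1) ^ ((p - 1) div 2) * Legendre 5 (int p) = 1] (mod int p)" .
  have QR: "Legendre (int p) 5 * Legendre 5 (int p) = 1"
    using Quadratic_Reciprocity[of p 5] \<open>prime p\<close> p2 \<open>p \<noteq> 5\<close> by simp
  have "\<not> 5 dvd p" using \<open>prime p\<close> \<open>p \<noteq> 5\<close> primes_dvd_imp_eq[of 5 p] by auto
  then have p5: "p mod 5 = 1 \<or> p mod 5 = 2 \<or> p mod 5 = 3 \<or> p mod 5 = 4" by presburger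
  have "\<not> [int p = 0] (mod 5)" using \<open>\<not> 5 dvd p\<close> by (simp add: cong_0_iff) presburger
  moreover have "QuadRes 5 (int p)" if "p mod 5 = 1 \<or> p mod 5 = 4"
  proof -
    have "[1\<^sup>2 = int p] (mod 5) \<or> [2\<^sup>2 = int p] (mod 5)"
      using that unfolding cong_def by simp presburger
    then show ?thesis unfolding QuadRes_def by blast
  qed
  moreover have "\<not> QuadRes 5 (int p)" if p23: "p mod 5 = 2 \<or> p mod 5 = 3"
  proof
    assume "QuadRes 5 (int p)"
    then obtain y where "y\<^sup>2 mod 5 = int p mod 5" unfolding QuadRes_def cong_def by blast
    then have "(y mod 5)\<^sup>2 mod 5 = int p mod 5" by (simp add: power_mod)
    moreover have "int p mod 5 = int (p mod 5)" by (simp add: zmod_int)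
    then have "int p mod 5 = 2 \<or> int p mod 5 = 3" using p23 by auto
    moreover have "y mod 5 = 0 \<or> y mod 5 = 1 \<or> y mod 5 = 2 \<or> y mod 5 = 3 \<or> y mod 5 = 4"
      by presburger
    ultimately show False by (elim disjE) simp_all
  qed
  ultimately have L5p: "Legendre 5 (int p) = (if p mod 5 = 1 \<or> p mod 5 = 4 then 1 else -1)"
    using QR p5 unfolding Legendre_def[of "int p" 5] by (auto simp del: One_nat_def)
  define h where "h = (p - 1) div 2"
  have "even h \<longleftrightarrow> Legendre 5 (int p) = 1"
  proof -
    have "\<not> [-1 = 1] (mod int p)"
    proof
      assume "[-1 = 1] (mod int p)"
      then have "int p dvd 2" by (simp add: cong_iff_dvd_diff)
      then show False using p2 zdvd_imp_le by fastforce
    qed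
    then show ?thesis using c unfolding h_def[symmetric] L5p
      by (cases "even h") (auto split: if_splits)
  qed
  then have h5: "even h \<longleftrightarrow> p mod 5 = 1 \<or> p mod 5 = 4" unfolding L5p by simp
  have "p = 2 * h + 1" unfolding h_def using \<open>odd p\<close> by presburger
  then have "p mod 4 = (if even h then 1 else 3)" by presburger
  then have "p mod 20 mod 4 = (if even h then 1 else 3)" by (simp add: mod_mod_cancel)
  moreover have "p mod 20 mod 5 = p mod 5" by (simp add: mod_mod_cancel)
  ultimately have "p mod 20 mod 4 = 1 \<and> (p mod 20 mod 5 = 1 \<or> p mod 20 mod 5 = 4) \<or>
      p mod 20 mod 4 = 3 \<and> (p mod 20 mod 5 = 2 \<or> p mod 20 mod 5 = 3)"
    using h5 p5 by metis
  moreover have "\<forall>x\<in>{..<20::nat}. (x mod 4 = 1 \<and> (x mod 5 = 1 \<or> x mod 5 = 4) \<or>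
      x mod 4 = 3 \<and> (x mod 5 = 2 \<or> x mod 5 = 3)) \<longrightarrow> x \<in> {1, 3, 7, 9}"
    by code_simp
  moreover have "p mod 20 \<in> {..<20}" by simp
  ultimately show ?thesis by blast
qed

text \<open>The classes \<open>1, 3, 7, 9\<close> are closed under multiplication modulo
  \<open>20\<close>, so the prime case extends by splitting off prime factors.\<close>

lemma dvd_square_plus_5:
  fixes M :: nat and w :: int
  assumes "int M dvd w\<^sup>2 + 5" "odd M" "\<not> 5 dvd M"
  shows "M mod 20 \<in> {1, 3, 7, 9}"
  using assms
proof (induction M rule: less_induct)
  case (less M)
  show ?case
  proof (cases "M = 1")
    case False
    then obtain p where p: "prime p" "p dvd M" using prime_factor_nat by blast
    then obtain N where N: "M = p * N" by blast
    have "p \<noteq> 2" "p \<noteq> 5" using p less.prems by auto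
    moreover have "int p dvd w\<^sup>2 + 5" "int N dvd w\<^sup>2 + 5"
      using less.prems(1) unfolding N by (auto intro: dvd_mult_left dvd_mult_right)
    ultimately have P: "p mod 20 \<in> {1, 3, 7, 9}" using prime_dvd_square_plus_5 p by blast
    have "N > 0" using less.prems(2) N by (cases N) auto
    then have "N < M" using N prime_gt_1_nat[OF p(1)] by simp
    moreover have "odd N" using less.prems(2) unfolding N by simp
    moreover have "\<not> 5 dvd N" using less.prems(3) unfolding N by (metis dvd_mult)
    ultimately have Q: "N mod 20 \<in> {1, 3, 7, 9}"
      using less.IH \<open>int N dvd w\<^sup>2 + 5\<close> by blast
    have "M mod 20 = (p mod 20) * (N mod 20) mod 20" unfolding N by (simp add: mod_mult_eq)
    moreover have "(p mod 20) * (N mod 20) mod 20 \<in> {1, 3, 7, 9}"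
      using P Q by (elim insertE emptyE) simp_all
    ultimately show ?thesis by simp
  qed simp
qed

text \<open>Cohn's method: with \<open>n = 2\<^sup>r g \<plusminus> 1\<close> and \<open>M = pt (2\<^sup>r)\<close> one gets
  \<open>4 H\<^sup>2 + 3 = pt (2 n) \<equiv> - pt 2 = - 7\<close> modulo \<open>M\<close>, and \<open>2\<close> is a square modulo \<open>M\<close>.\<close>

lemma simultaneous_pell:
  fixes P H z :: int
  assumes "4 * P\<^sup>2 = 3 * z\<^sup>2 + 1" "H\<^sup>2 = 2 * P\<^sup>2 - 1" "P > 0" "z \<ge> 0"
  shows "P = 1"
proof -
  have "(2 * P)\<^sup>2 - 3 * z\<^sup>2 = 1" using assms(1) by (simp add: power_mult_distrib)
  then obtain n where n: "2 * P = pt n" using pell3_complete[of "2 * P" z] assms by auto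
  have "odd n" using pell3_parity[of n] n by (metis dvd_triv_left)
  have p2n: "pt (2 * n) = 4 * H\<^sup>2 + 3"
    unfolding pell3_double n[symmetric] assms(2) by (simp add: power_mult_distrib)
  have "n = 1"
  proof (rule ccontr)
    assume "n \<noteq> 1"
    with \<open>odd n\<close> have "\<exists>j>0. n = 4 * j + 1 \<or> n + 1 = 4 * j" by presburger
    then obtain j where j: "j > 0" "n = 4 * j + 1 \<or> n + 1 = 4 * j" by blast
    obtain g where g: "j = 2 ^ multiplicity 2 j * g" "\<not> 2 dvd g"
      using multiplicity_decompose'[of j 2] j by auto
    \<comment> \<open>The exponent of \<open>2\<close> in \<open>4 * j\<close> is
      \<open>multiplicity 2 j + 2\<close>, here \<open>Suc r\<close>, so that the doubling formula
      applies to \<open>M = pt (2 ^ Suc r)\<close>.\<close>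
    define r where "r = multiplicity 2 j + 1"
    define K where "K = 4 * j"
    have K: "K = 2 ^ Suc r * g" unfolding K_def r_def by (subst g(1)) simp
    have nK: "2 * n = 2 * K + 2 \<or> 2 * K = 2 * n + 2" using j unfolding K_def by linarith
    define M where "M = pt (2 ^ Suc r)"
    have "M dvd pt K"
    proof -
      obtain i where "g = 2 * i + 1" using g(2) by (meson oddE)
      then show ?thesis unfolding K M_def using pell3_dvd_odd_multiple by metis
    qed
    \<comment> \<open>By the doubling formulas, shifting an index by \<open>2 * K\<close> changes
      the sign modulo \<open>M\<close>.\<close>
    then have M2K: "M dvd pt (2 * K) + 1" "M dvd ps (2 * K)"
      unfolding pell3_double by (simp_all add: power2_eq_square)
    have e: "pt 2 = 7" "ps 2 = 4" by (simp_all add: numeral_eq_Suc)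
    have "M dvd pt (2 * n) + 7"
      using nK
    proof
      assume "2 * n = 2 * K + 2"
      then have "pt (2 * n) + 7 = 7 * (pt (2 * K) + 1) + 12 * ps (2 * K)"
        using pell3_add[of "2 * K" 2] e by simp
      then show ?thesis using M2K by (metis dvd_add dvd_mult)
    next
      assume "2 * K = 2 * n + 2"
      then have "pt (2 * n) + 7 = 7 * (pt (2 * K) + 1) + (-12) * ps (2 * K)"
        using pell3_add[of "2 * n" 2] e by simp
      then show ?thesis using M2K by (metis dvd_add dvd_mult)
    qed
    moreover have "4 * H\<^sup>2 + 3 + 7 = 2 * (2 * H\<^sup>2 + 5)" by simp
    ultimately have M2H: "M dvd 2 * (2 * H\<^sup>2 + 5)" unfolding p2n by metis
    have M17: "M mod 20 = 17" unfolding M_def r_def by (rule pell3_power2_mod_20) simp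
    then have "odd M" by presburger
    then have "coprime M 2" by simp
    then have MH: "M dvd 2 * H\<^sup>2 + 5" using M2H by (metis coprime_dvd_mult_right_iff)
    define T where "T = pt (2 ^ r)"
    have MT: "M = 2 * T\<^sup>2 - 1" unfolding M_def T_def power_Suc pell3_double ..
    \<comment> \<open>\<open>M = 2 T^2 - 1\<close> makes \<open>2\<close> the square of
      \<open>2 T\<close> modulo \<open>M\<close>, which turns \<open>2 H^2 + 5\<close> into a square
      plus \<open>5\<close>.\<close>
    have "(2 * H * T)\<^sup>2 + 5 = 2 * H\<^sup>2 * (2 * T\<^sup>2 - 1) + (2 * H\<^sup>2 + 5)"
      by (simp add: power2_eq_square algebra_simps)
    then have "M dvd (2 * H * T)\<^sup>2 + 5" using MH unfolding MT[symmetric]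
      by (metis dvd_add dvd_triv_right)
    moreover have "M > 0" unfolding M_def using pell3_pos by blast
    then obtain N where N: "M = int N" by (metis zero_less_imp_eq_int)
    moreover have "int (N mod 20) = int 17" using M17 unfolding N by (simp add: zmod_int)
    then have "N mod 20 = 17" by (simp only: of_nat_eq_iff)
    moreover from this have "odd N" by presburger
    moreover have "\<not> 5 dvd N" using \<open>N mod 20 = 17\<close> by presburger
    ultimately have "N mod 20 \<in> {1, 3, 7, 9}" using dvd_square_plus_5 by blast
    with \<open>N mod 20 = 17\<close> show False by simp
  qed
  then show ?thesis using n by simp
qed

section \<open>Identities between balancing and Lucas-balancing numbers\<close>

section \<open>Balancing numbers\<close>

text \<open>\<open>lucas_balancing n + balancing n * sqrt 8\<close> is
  \<open>(3 + sqrt 8) ^ n\<close>; the coupled recurrence keeps everything in the integers.\<close>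

primrec lucas_balancing :: "nat \<Rightarrow> int" where
  "lucas_balancing 0 = 1"
| "lucas_balancing (Suc n) = 3 * lucas_balancing n + 8 * balancing n"

lemma balancing_Suc: "balancing (Suc n) = 3 * balancing n + lucas_balancing n"
  by (induction n rule: balancing.induct) simp_all

lemma balancing_norm: "(lucas_balancing n)\<^sup>2 = 8 * (balancing n)\<^sup>2 + 1"
  by (induction n) (simp_all add: balancing_Suc power2_eq_square algebra_simps del: balancing.simps(3))

lemma balancing_add_conj:
  "balancing (m + n) = balancing m * lucas_balancing n + lucas_balancing m * balancing n \<and>
   lucas_balancing (m + n) = lucas_balancing m * lucas_balancing n + 8 * balancing m * balancing n"
  by (induction m) (simp_all add: balancing_Suc algebra_simps del: balancing.simps(3))

lemmas balancing_add = balancing_add_conj[THEN conjunct1]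
lemmas lucas_balancing_add = balancing_add_conj[THEN conjunct2]

lemma balancing_double: "balancing (2 * n) = 2 * balancing n * lucas_balancing n"
  unfolding mult_2[of n] balancing_add by simp

lemma lucas_balancing_double: "lucas_balancing (2 * n) = 16 * (balancing n)\<^sup>2 + 1"
  using balancing_norm[of n] unfolding mult_2[of n] lucas_balancing_add
  by (simp add: power2_eq_square)

text \<open>Sum-to-product formula with half sum \<open>m + b\<close> and half difference
  \<open>b\<close> of the indices; the two expansions agree by the norm equation at
  \<open>b\<close>.\<close>

lemma balancing_sum:
  "balancing (m + 2 * b) + balancing m = 2 * balancing (m + b) * lucas_balancing b"
proof -
  let ?B = "balancing m" and ?C = "lucas_balancing m"
    and ?x = "balancing b" and ?y = "lucas_balancing b"
  have "balancing (m + 2 * b) = ?B * (16 * ?x\<^sup>2 + 1) + ?C * (2 * ?x * ?y)"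
    unfolding balancing_add balancing_double lucas_balancing_double ..
  moreover have "2 * balancing (m + b) * ?y = 2 * (?B * ?y\<^sup>2) + 2 * ?C * ?x * ?y"
    unfolding balancing_add by (simp add: power2_eq_square algebra_simps)
  ultimately show ?thesis unfolding balancing_norm by (simp add: algebra_simps)
qed

lemma balancing_bounds: "balancing n \<ge> 0 \<and> lucas_balancing n \<ge> 1"
  by (induction n) (auto simp: balancing_Suc simp del: balancing.simps(3))

lemma balancing_pos: "n > 0 \<Longrightarrow> balancing n > 0"
  using balancing_bounds[of "n - 1"] balancing_Suc[of "n - 1"] by simp

lemma lucas_balancing_pos: "lucas_balancing n > 0"
  using balancing_bounds[of n] by linarith

lemma balancing_eq_1:
  assumes "balancing n = 1"
  shows "n = 1"
proof (rule ccontr)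
  assume "n \<noteq> 1"
  moreover have "n \<noteq> 0" using assms by (cases n) auto
  ultimately obtain k where k: "n = Suc (Suc k)" by (metis One_nat_def not0_implies_Suc)
  have "balancing n > 1"
    unfolding k balancing_Suc[of "Suc k"]
    using balancing_pos[of "Suc k"] lucas_balancing_pos[of "Suc k"] by linarith
  with assms show False by simp
qed

section \<open>Parity, divisibility and coprimality of the two sequences\<close>

lemma odd_lucas_balancing: "odd (lucas_balancing n)"
  by (induction n) auto

lemma even_balancing_iff: "even (balancing n) \<longleftrightarrow> even n"
  using odd_lucas_balancing
  by (induction n) (simp_all add: balancing_Suc del: balancing.simps(2,3))

lemma coprime_balancing_lucas: "coprime (balancing n) (lucas_balancing n)"
proof (rule coprimeI)
  fix d assume d: "d dvd balancing n" "d dvd lucas_balancing n"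
  then have "d dvd (lucas_balancing n)\<^sup>2 - 8 * (balancing n)\<^sup>2"
    by (simp add: power2_eq_square)
  then show "is_unit d" unfolding balancing_norm by simp
qed

lemma balancing_dvd_multiple: "balancing k dvd balancing (k * j)"
  by (induction j) (auto simp: balancing_add)

lemma lucas_balancing_dvd_odd_multiple:
  assumes "odd j"
  shows "lucas_balancing k dvd lucas_balancing (k * j)"
proof -
  have "lucas_balancing k dvd lucas_balancing (k + 2 * k * i)" for i
  proof (induction i)
    case (Suc i)
    have "lucas_balancing (k + 2 * k * Suc i) = lucas_balancing (k + 2 * k * i) * lucas_balancing (2 * k)
        + 8 * balancing (k + 2 * k * i) * (2 * balancing k * lucas_balancing k)"
      by (simp only: lucas_balancing_add balancing_double mult_Suc_right add.assoc[symmetric] add.commute[of "2 * k"]) 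
    then show ?case using Suc.IH by (metis dvd_add dvd_mult dvd_mult2 dvd_triv_right)
  qed simp
  moreover obtain i where "j = 2 * i + 1" using assms by (rule oddE)
  then have "k * j = k + 2 * k * i" by (simp add: algebra_simps)
  ultimately show ?thesis by metis
qed

lemma lucas_balancing_dvd_balancing:
  assumes "even j"
  shows "lucas_balancing k dvd balancing (k * j)"
proof -
  obtain i where "j = 2 * i" using assms by (rule evenE)
  then have "balancing (2 * k) dvd balancing (k * j)"
    using balancing_dvd_multiple[of "2 * k" i] by (simp add: mult_ac)
  then show ?thesis unfolding balancing_double by (metis dvd_mult_right)
qed

text \<open>The two numbers divide the coprime pair with common index \<open>a * b\<close>; odd
  \<open>a\<close> is what carries \<open>lucas_balancing b\<close> to
  \<open>lucas_balancing (a * b)\<close>.\<close>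

lemma coprime_balancing_odd:
  assumes "odd a"
  shows "coprime (balancing a) (lucas_balancing b)"
proof (rule coprime_divisors)
  show "balancing a dvd balancing (a * b)" by (rule balancing_dvd_multiple)
  show "lucas_balancing b dvd lucas_balancing (a * b)"
    using lucas_balancing_dvd_odd_multiple[OF assms, of b] by (simp only: mult.commute)
qed (rule coprime_balancing_lucas)

lemma coprime_lucas_balancing:
  assumes "odd a" "even b"
  shows "coprime (lucas_balancing a) (lucas_balancing b)"
proof (rule coprime_divisors)
  show "lucas_balancing a dvd balancing (a * b)"
    using assms(2) by (rule lucas_balancing_dvd_balancing)
  show "lucas_balancing b dvd lucas_balancing (a * b)"
    using lucas_balancing_dvd_odd_multiple[OF assms(1), of b] by (simp only: mult.commute)
qed (rule coprime_balancing_lucas)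

lemma coprime_two_lucas_balancing: "coprime (lucas_balancing n) 2"
  using odd_lucas_balancing by simp

text \<open>Each further doubling contributes \<open>2 * L\<close>, with \<open>L\<close> the
  Lucas-balancing number of the old index. As \<open>lucas_balancing N\<close> divides the balancing
  number of that index, it is coprime to \<open>L\<close>.\<close>

lemma balancing_two_power_factor:
  assumes "N > 0"
  shows "\<exists>R>0. balancing (2 ^ Suc k * N) = lucas_balancing N * R \<and> coprime (lucas_balancing N) R"
proof (induction k)
  case 0
  have "coprime (lucas_balancing N) (2 * balancing N)"
    using coprime_two_lucas_balancing coprime_balancing_lucas
    by (simp add: coprime_commute)
  moreover have "2 * balancing N > 0" using balancing_pos assms by simp
  moreover have "balancing (2 ^ Suc 0 * N) = lucas_balancing N * (2 * balancing N)"
    by (simp add: balancing_double)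
  ultimately show ?case by blast
next
  case (Suc k)
  then obtain R where R: "R > 0" "balancing (2 ^ Suc k * N) = lucas_balancing N * R"
    "coprime (lucas_balancing N) R" by blast
  define L where "L = lucas_balancing (2 ^ Suc k * N)"
  have "lucas_balancing N dvd balancing (2 ^ Suc k * N)"
    using R by simp
  then have "coprime (lucas_balancing N) L"
    unfolding L_def by (rule coprime_divisors) (rule dvd_refl coprime_balancing_lucas)+
  then have "coprime (lucas_balancing N) (2 * R * L)"
    using R coprime_two_lucas_balancing by simp
  moreover have "2 * R * L > 0" using R lucas_balancing_pos unfolding L_def by simp
  moreover have "balancing (2 ^ Suc (Suc k) * N) = lucas_balancing N * (2 * R * L)"
    using balancing_double[of "2 ^ Suc k * N"] unfolding R(2) L_def[symmetric] by (simp add: mult_ac)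
  ultimately show ?case by blast
qed

text \<open>\<open>P\<close> and \<open>H\<close> are the Pell and half-companion Pell numbers of index \<open>n\<close>.\<close>

lemma odd_index_factorization:
  assumes "odd n"
  obtains P H where "P > 0" "H > 0" "H\<^sup>2 = 2 * P\<^sup>2 - 1" "balancing n = P * H"
    "lucas_balancing n = 4 * P\<^sup>2 - 1"
proof -
  have "\<exists>P>0. \<exists>H>0. H\<^sup>2 = 2 * P\<^sup>2 - 1 \<and> balancing (1 + 2 * i) = P * H \<and>
    lucas_balancing (1 + 2 * i) = 4 * P\<^sup>2 - 1" for i
  proof (induction i)
    case 0
    show ?case by (intro exI[of _ 1]) simp
  next
    case (Suc i)
    then obtain P H where PH: "P > 0" "H > 0" "H\<^sup>2 = 2 * P\<^sup>2 - 1" "balancing (1 + 2 * i) = P * H"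
      "lucas_balancing (1 + 2 * i) = 4 * P\<^sup>2 - 1" by blast
    define P' where "P' = 2 * H + 3 * P"
    define H' where "H' = 3 * H + 4 * P"
    have e: "1 + 2 * Suc i = (1 + 2 * i) + 2" by simp
    have B2: "balancing 2 = 6" "lucas_balancing 2 = 17" by (simp_all add: numeral_eq_Suc)
    have "P' > 0" "H' > 0" unfolding P'_def H'_def using PH by simp_all
    moreover have "H'\<^sup>2 = 2 * P'\<^sup>2 - 1"
      unfolding P'_def H'_def using PH(3) by (simp add: power2_eq_square algebra_simps)
    moreover have "balancing (1 + 2 * Suc i) = P' * H'"
      unfolding e balancing_add[of "1 + 2 * i" 2] PH(4,5) B2 P'_def H'_def
      using PH(3) by (simp add: power2_eq_square algebra_simps)
    moreover have "lucas_balancing (1 + 2 * Suc i) = 4 * P'\<^sup>2 - 1"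
      unfolding e lucas_balancing_add[of "1 + 2 * i" 2] PH(4,5) B2 P'_def
      using PH(3) by (simp add: power2_eq_square algebra_simps)
    ultimately show ?case by blast
  qed
  moreover obtain i where "n = 1 + 2 * i" using assms by (metis add.commute oddE)
  ultimately show thesis using that by metis
qed

section \<open>Perfect powers among the factors\<close>

lemma two_not_difference_of_powers:
  fixes v w :: int
  assumes "w ^ q - v ^ q = 2" "v > 0" "w > 0" "q \<ge> 2"
  shows False
proof -
  have "v < w"
  proof (rule ccontr)
    assume "\<not> v < w"
    then have "w ^ q \<le> v ^ q" using assms by (intro power_mono) auto
    with assms show False by simp
  qed
  obtain k where k: "q = Suc (Suc k)" using \<open>q \<ge> 2\<close> by (metis add_2_eq_Suc le_Suc_ex)
  have "v ^ k \<ge> 1" using assms by (simp add: one_le_power)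
  have "w ^ k \<ge> v ^ k" using \<open>v < w\<close> assms by (intro power_mono) auto
  \<comment> \<open>From \<open>w >= v + 1\<close>, the power \<open>w ^ q\<close> exceeds
    \<open>v ^ q\<close> by at least \<open>(2 v + 1) v^(q - 2)\<close>, which is at least
    \<open>3\<close>.\<close>
  have "w ^ q = w\<^sup>2 * w ^ k" unfolding k by (simp add: power2_eq_square)
  also have "\<dots> \<ge> (v + 1)\<^sup>2 * v ^ k"
    using \<open>v < w\<close> assms \<open>w ^ k \<ge> v ^ k\<close> by (intro mult_mono power_mono) auto
  finally have "w ^ q \<ge> v ^ q + (2 * v + 1) * v ^ k"
    unfolding k by (simp add: power2_eq_square algebra_simps)
  moreover have "(2 * v + 1) * v ^ k \<ge> 3 * 1"
    using assms \<open>v ^ k \<ge> 1\<close> by (intro mult_mono) auto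
  ultimately show False using assms by simp
qed

text \<open>The number is \<open>(2 P - 1)(2 P + 1)\<close> with coprime factors, so two
  \<open>q\<close>-th powers would differ by \<open>2\<close>.\<close>

lemma lucas_balancing_odd_not_power:
  assumes "odd n" "q \<ge> 2"
  shows "lucas_balancing n \<noteq> x ^ q"
proof
  assume x: "lucas_balancing n = x ^ q"
  obtain P H where P: "P > 0" "lucas_balancing n = 4 * P\<^sup>2 - 1"
    using odd_index_factorization[OF \<open>odd n\<close>] by metis
  have eq: "(2 * P - 1) * (2 * P + 1) = x ^ q"
    using x P by (simp add: power2_eq_square algebra_simps)
  have "coprime (2 * P - 1) (2 * P + 1)"
  proof (rule coprimeI)
    fix d assume d: "d dvd 2 * P - 1" "d dvd 2 * P + 1"
    have "d dvd (2 * P + 1) - (2 * P - 1)" using d(2,1) by (rule dvd_diff)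
    then have "d dvd 2" by simp
    then have "d dvd 2 * P" by (rule dvd_mult2)
    with d(2) have "d dvd (2 * P + 1) - 2 * P" by (rule dvd_diff)
    then show "is_unit d" by simp
  qed
  then obtain v w where "v > 0" "w > 0" "2 * P - 1 = v ^ q" "2 * P + 1 = w ^ q"
    using coprime_mult_eq_power2[OF _ eq] P assms by auto
  then show False using two_not_difference_of_powers[of w q v] assms by simp
qed

text \<open>The number is one more than the square of \<open>4 * balancing n\<close>. For even
  \<open>q\<close> two positive squares would differ by \<open>1\<close>; for odd \<open>q\<close>
  Lebesgue's theorem applies.\<close>

lemma lucas_balancing_double_not_power:
  assumes "n > 0" "q \<ge> 2"
  shows "lucas_balancing (2 * n) \<noteq> x ^ q"
proof
  assume "lucas_balancing (2 * n) = x ^ q"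
  then have eq: "(4 * balancing n)\<^sup>2 + 1 = x ^ q"
    unfolding lucas_balancing_double by (simp add: power_mult_distrib)
  have pos: "4 * balancing n > 0" using balancing_pos assms by simp
  show False
  proof (cases "even q")
    case True
    then obtain k where "q = 2 * k" by (rule evenE)
    then have "(4 * balancing n)\<^sup>2 + 1 = \<bar>x ^ k\<bar>\<^sup>2"
      using eq by (simp add: mult.commute flip: power_mult)
    then have sq: "(\<bar>x ^ k\<bar> - 4 * balancing n) * (\<bar>x ^ k\<bar> + 4 * balancing n) = 1"
      by (simp add: power2_eq_square algebra_simps)
    then have "\<bar>x ^ k\<bar> + 4 * balancing n = 1"
      using pos by (auto simp: zmult_eq_1_iff)
    with sq pos show False by simp
  next
    case False
    then have "4 * balancing n = 0"
      using lebesgue_square_plus_one[OF eq] assms by simp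
    with pos show False by simp
  qed
qed

text \<open>\<open>lucas_balancing N\<close> is coprime to the whole cofactor, made up of
  \<open>2\<close>, \<open>R\<close> and \<open>lucas_balancing b\<close>. The cases of interest
  take for \<open>N\<close> the odd part of the index or its double.\<close>

lemma lucas_balancing_power_of_factor:
  assumes "2 * balancing (2 ^ Suc k * N) * lucas_balancing b = x ^ q" "N > 0" "q \<ge> 2"
    and "coprime (lucas_balancing N) (lucas_balancing b)"
  shows "\<exists>v. lucas_balancing N = v ^ q"
proof -
  obtain R where R: "balancing (2 ^ Suc k * N) = lucas_balancing N * R" "coprime (lucas_balancing N) R"
    using balancing_two_power_factor[OF \<open>N > 0\<close>] by blast
  have "coprime (lucas_balancing N) (2 * R * lucas_balancing b)"
    using R assms(4) coprime_two_lucas_balancing by simp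
  moreover have "lucas_balancing N * (2 * R * lucas_balancing b) = x ^ q"
    using assms(1) unfolding R(1) by (simp add: mult_ac)
  ultimately show ?thesis
    using coprime_mult_eq_power_int[of "lucas_balancing N" _ x q] lucas_balancing_pos assms(3)
    by (metis not_numeral_le_zero zero_less_iff_neq_zero)
qed

text \<open>The coprime factors \<open>P\<close> and \<open>H\<close> are squares \<open>t^2\<close>
  and \<open>u^2\<close>, and \<open>H^2 = 2 P^2 - 1\<close> becomes
  \<open>u^4 + 1 = 2 t^4\<close>.\<close>

lemma balancing_odd_square:
  assumes "odd n" "balancing n = s\<^sup>2"
  shows "n = 1"
proof -
  obtain P H where PH: "P > 0" "H > 0" "H\<^sup>2 = 2 * P\<^sup>2 - 1" "balancing n = P * H"
    using odd_index_factorization[OF \<open>odd n\<close>] by metis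
  have "coprime P H"
  proof (rule coprimeI)
    fix d assume "d dvd P" "d dvd H"
    then have "d dvd 2 * P\<^sup>2 - H\<^sup>2" by (simp add: power2_eq_square)
    then show "is_unit d" using PH(3) by simp
  qed
  then obtain t u where tu: "t > 0" "u > 0" "P = t\<^sup>2" "H = u\<^sup>2"
    using coprime_mult_eq_power2[of P H s 2] PH assms by auto
  have "u ^ 4 + 1 = 2 * t ^ 4" using PH(3) unfolding tu by (simp flip: power_mult)
  then have "u = 1" using fourth_powers_near_double tu by blast
  then have "H = 1" using tu by simp
  then have "P\<^sup>2 = 1" using PH(3) by simp
  then have "P = 1" using PH(1) by (simp add: power2_eq_1_iff)
  then show ?thesis using PH(4) \<open>H = 1\<close> balancing_eq_1 by simp
qed

text \<open>With \<open>w = 3 z\<close> the hypothesis reads \<open>4 P^2 = 3 z^2 + 1\<close>, to be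
  solved together with \<open>H^2 = 2 P^2 - 1\<close>.\<close>

lemma three_lucas_balancing_square:
  assumes "odd n" "3 * lucas_balancing n = w\<^sup>2"
  shows "n = 1"
proof -
  obtain P H where PH: "P > 0" "H > 0" "H\<^sup>2 = 2 * P\<^sup>2 - 1" "balancing n = P * H"
    "lucas_balancing n = 4 * P\<^sup>2 - 1"
    using odd_index_factorization[OF \<open>odd n\<close>] by metis
  have "prime (3::int)" by simp
  moreover have "3 dvd w\<^sup>2" using assms(2) by (metis dvd_triv_left)
  ultimately have "3 dvd w" by (metis prime_dvd_power)
  then obtain z where z: "w = 3 * z" by blast
  have "4 * P\<^sup>2 = 3 * \<bar>z\<bar>\<^sup>2 + 1"
    using assms(2) unfolding z PH(5) by (simp add: power_mult_distrib)
  then have "P = 1" using simultaneous_pell PH by (metis abs_ge_zero)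
  then have "H\<^sup>2 = 1" using PH(3) by simp
  then have "H = 1" using PH(2) by (simp add: power2_eq_1_iff)
  then show ?thesis using PH(4) \<open>P = 1\<close> balancing_eq_1 by simp
qed

lemma balancing_lucas_product_power:
  assumes eq: "2 * balancing a * lucas_balancing b = x ^ q" and "a > 0" "q \<ge> 2"
  shows "a = 2 \<and> b = 1 \<and> q = 2"
proof -
  have "even (x ^ q)" unfolding eq[symmetric] by simp
  then have "even x" by simp
  then obtain y where y: "x = 2 * y" by blast
  obtain j where j: "q = Suc (Suc j)" using \<open>q \<ge> 2\<close> by (metis add_2_eq_Suc le_Suc_ex)
  obtain A where A: "a = 2 ^ multiplicity 2 a * A" "odd A"
    using multiplicity_decompose'[of a 2] \<open>a > 0\<close> by auto
  have "A > 0" using A(2) by (cases A) auto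
  \<comment> \<open>\<open>x ^ q\<close> is divisible by \<open>4\<close>, whereas an odd
    \<open>a\<close> would make the left side twice an odd number.\<close>
  have "multiplicity 2 a \<noteq> 0"
  proof
    assume "multiplicity 2 a = 0"
    then have "odd a" using A by simp
    then have "odd (balancing a * lucas_balancing b)"
      using even_balancing_iff odd_lucas_balancing by simp
    moreover have "balancing a * lucas_balancing b = 2 * (y\<^sup>2 * x ^ j)"
      using eq unfolding j by (simp add: y power2_eq_square)
    ultimately show False by simp
  qed
  then obtain k where k: "multiplicity 2 a = Suc k" using not0_implies_Suc by blast
  have odd_b: "odd b"
  proof (rule ccontr)
    assume "\<not> odd b"
    then have "coprime (lucas_balancing A) (lucas_balancing b)"
      using coprime_lucas_balancing A(2) by blast
    moreover have "2 * balancing (2 ^ Suc k * A) * lucas_balancing b = x ^ q"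
      using eq A(1) unfolding k by simp
    ultimately obtain v where "lucas_balancing A = v ^ q"
      using lucas_balancing_power_of_factor \<open>A > 0\<close> \<open>q \<ge> 2\<close> by blast
    then show False using lucas_balancing_odd_not_power A(2) \<open>q \<ge> 2\<close> by blast
  qed
  \<comment> \<open>For \<open>k > 0\<close> the factor with \<open>N = 2 * A\<close> splits off,
    since \<open>b\<close> is odd; one power of \<open>2\<close> moves into
    \<open>N\<close>.\<close>
  have "k = 0"
  proof (rule ccontr)
    assume "k \<noteq> 0"
    then obtain i where i: "k = Suc i" using not0_implies_Suc by blast
    have "2 * balancing (2 ^ Suc i * (2 * A)) * lucas_balancing b = x ^ q"
      using eq A(1) unfolding k i by (simp add: mult_ac)
    moreover have "coprime (lucas_balancing (2 * A)) (lucas_balancing b)"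
      using coprime_lucas_balancing[of b "2 * A"] odd_b by (simp add: coprime_commute)
    ultimately obtain v where "lucas_balancing (2 * A) = v ^ q"
      using lucas_balancing_power_of_factor[of i "2 * A" b x q] \<open>A > 0\<close> \<open>q \<ge> 2\<close> by (metis nat_0_less_mult_iff zero_less_numeral)
    then show False using lucas_balancing_double_not_power \<open>A > 0\<close> \<open>q \<ge> 2\<close> by blast
  qed
  then have a: "a = 2 * A" using A(1) k by simp
  define L where "L = lucas_balancing A * lucas_balancing b"
  \<comment> \<open>Both sides of the equation divided by \<open>4\<close>. The left side is odd, so
    no factor \<open>x\<close> can remain on the right.\<close>
  have BL: "balancing A * L = y\<^sup>2 * x ^ j"
    using eq unfolding a balancing_double j L_def by (simp add: y power2_eq_square mult_ac)
  have "j = 0"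
  proof (rule ccontr)
    assume "j \<noteq> 0"
    then have "even (balancing A * L)" unfolding BL using \<open>even x\<close> by simp
    then show False
      using A(2) even_balancing_iff odd_lucas_balancing unfolding L_def by simp
  qed
  then have BL2: "balancing A * L = y\<^sup>2" using BL by simp
  have "coprime (balancing A) L"
    unfolding L_def using coprime_balancing_odd A(2) by simp
  moreover have "balancing A > 0" "L > 0"
    unfolding L_def using balancing_pos \<open>A > 0\<close> lucas_balancing_pos by simp_all
  ultimately obtain s w where sw: "balancing A = s\<^sup>2" "L = w\<^sup>2"
    using coprime_mult_eq_power2[OF _ BL2] by (metis pos2)
  have "A = 1" using balancing_odd_square A(2) sw(1) by blast
  moreover from this have "3 * lucas_balancing b = w\<^sup>2"
    using sw(2) unfolding L_def by simp
  then have "b = 1" using three_lucas_balancing_square odd_b by blast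
  ultimately show ?thesis using a j \<open>j = 0\<close> by simp
qed

theorem theorem1p1:
  fixes n m q :: nat and x :: int
  assumes "n \<ge> 1" and "m \<ge> 1" and "x \<ge> 1" and "q \<ge> 2"
    and "n \<ge> m" and "n mod 2 = m mod 2"
  shows "balancing n + balancing m = x ^ q \<longleftrightarrow>
    n = 3 \<and> m = 1 \<and> x = 6 \<and> q = 2"
proof
  assume eq: "balancing n + balancing m = x ^ q"
  obtain b where b: "n = m + 2 * b"
  proof -
    have "even (n - m)" using assms(5,6) by presburger
    then obtain b where "n - m = 2 * b" by (rule evenE)
    then show thesis using that[of b] assms(5) by simp
  qed
  have "2 * balancing (m + b) * lucas_balancing b = x ^ q"
    using eq unfolding b balancing_sum .
  then have "m + b = 2 \<and> b = 1 \<and> q = 2"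
    using balancing_lucas_product_power assms by simp
  then have nmq: "n = 3" "m = 1" "q = 2" using b by auto
  have "x\<^sup>2 = 6\<^sup>2" using eq unfolding nmq by (simp add: numeral_eq_Suc)
  then have "x = 6" using \<open>x \<ge> 1\<close> unfolding power2_eq_iff by linarith
  with nmq show "n = 3 \<and> m = 1 \<and> x = 6 \<and> q = 2" by simp
next
  assume "n = 3 \<and> m = 1 \<and> x = 6 \<and> q = 2"
  then show "balancing n + balancing m = x ^ q" by (simp add: numeral_eq_Suc)
qed

end
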